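(* Let $G$ be a locally compact abelian group with Haar measure $\mu=\mu_G$. Let $\Omega\subset G$ be a $0$-symmetric (i.e. $\Omega=-\Omega$) open neighborhood of $0$ and let $\Lambda\subset G$ be a subset satisfying $\Omega\cap(\Lambda-\Lambda)=\{0\}$. If $\rho:=\overline{D}^{\#}(\Lambda)>0$, then $\mathcal{T}_G(\Omega)\le 1/\rho$.
   Context: Groups are written additively, and the same Haar measure $\mu$ is used throughout. Positive definiteness: $f:G\to\mathbb{C}$ is positive definite if $\sum_{n,m=1}^N c_n\overline{c_m}f(x_n-x_m)\ge 0$ for all $N$, all $x_1,\dots,x_N\in G$ and all $c_1,\dots,c_N\in\mathbb{C}$. Turán constant: for a $0$-symmetric open set $\Omega\subset G$, $\mathcal{T}_G(\Omega)$ is the supremum of $\int_G f\,d\mu / f(0)$ over all (not identically zero) continuous positive definite functions $f\in L^1(G)$ whose support $\operatorname{supp} f$ is a closed set contained in $\Omega$. (It is known, by a theorem of Kolountzakis and Révész, that the supremum is the same if one only allows continuous positive definite $f$ whose support is a compact subset of $\Omega$; restricting to real-valued functions does not change it either.) Asymptotic uniform upper density: let $\mathcal{B}_0$ be the family of Borel sets of $G$ with compact closure. For $\Lambda\subset G$, $$\overline{D}^{\#}(\Lambda):=\inf_{C}\ \sup_{V\in\mathcal{B}_0}\frac{\#(\Lambda\cap V)}{\mu(C+V)},$$ where the infimum is over all (nonempty) compact sets $C\subset G$, the supremum is over nonempty $V\in\mathcal B_0$, $\#$ denotes cardinality, and $\mu$ is understood as outer measure if $C+V$ is not measurable. *)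

theory Defs
  imports "HOL-Analysis.Analysis" "HOL-Library.Set_Algebras"
begin

text \<open>
  A Haar measure is a nonzero translation-invariant Radon measure: outer regular on Borel sets
  and inner regular on open sets. No \<open>\<sigma>\<close>-compactness is assumed, so the measure need not be
  \<open>\<sigma>\<close>-finite.
\<close>

definition haar_measure :: "'a::topological_ab_group_add measure \<Rightarrow> bool" where
  "haar_measure M \<longleftrightarrow>
     sets M = sets borel \<and>
     emeasure M UNIV \<noteq> 0 \<and>
     (\<forall>K. compact K \<longrightarrow> emeasure M K < \<infinity>) \<and>
     (\<forall>a. \<forall>B \<in> sets borel. emeasure M ((+) a ` B) = emeasure M B) \<and>
     (\<forall>B \<in> sets borel. emeasure M B = (INF U \<in> {U. open U \<and> B \<subseteq> U}. emeasure M U)) \<and>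
     (\<forall>U. open U \<longrightarrow> emeasure M U = (SUP K \<in> {K. compact K \<and> K \<subseteq> U}. emeasure M K))"

definition positive_definite_fun :: "('a::ab_group_add \<Rightarrow> complex) \<Rightarrow> bool" where
  "positive_definite_fun f \<longleftrightarrow>
     (\<forall>(N::nat) (x :: nat \<Rightarrow> 'a) (c :: nat \<Rightarrow> complex).
        (\<Sum>n<N. \<Sum>m<N. c n * cnj (c m) * f (x n - x m)) \<in> \<real>\<^sub>\<ge>\<^sub>0)"

definition turan_admissible ::
    "'a::topological_ab_group_add measure \<Rightarrow> 'a set \<Rightarrow> ('a \<Rightarrow> complex) \<Rightarrow> bool" where
  "turan_admissible M \<Omega> f \<longleftrightarrow>
     continuous_on UNIV f \<and> positive_definite_fun f \<and> integrable M f \<and>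
     (\<exists>x. f x \<noteq> 0) \<and> closure {x. f x \<noteq> 0} \<subseteq> \<Omega>"

text \<open>
  For a positive definite \<open>f\<close> that is not identically zero, \<open>f 0\<close> is a positive real and
  \<open>f (- x) = cnj (f x)\<close>, so the quotient below is a real number; \<open>Re\<close> only changes its type.
\<close>

definition turan_constant :: "'a::topological_ab_group_add measure \<Rightarrow> 'a set \<Rightarrow> ereal" where
  "turan_constant M \<Omega> =
     (SUP f \<in> {f. turan_admissible M \<Omega> f}. ereal (Re ((\<integral>x. f x \<partial>M) / f 0)))"

text \<open>
  Cardinality is the counting measure, with value \<open>\<infinity>\<close> on infinite sets. In \<^typ>\<open>ennreal\<close>,
  \<open>a / 0 = \<infinity>\<close> for \<open>a \<noteq> 0\<close> and \<open>0 / 0 = 0\<close>. The sum \<open>C + V\<close> is the Minkowski sum.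
\<close>

definition asymp_uniform_upper_density ::
    "'a::topological_ab_group_add measure \<Rightarrow> 'a set \<Rightarrow> ennreal" where
  "asymp_uniform_upper_density M \<Lambda> =
     (INF C \<in> {C. compact C \<and> C \<noteq> {}}.
        SUP V \<in> {V. V \<in> sets borel \<and> compact (closure V) \<and> V \<noteq> {}}.
          emeasure (count_space UNIV) (\<Lambda> \<inter> V) / outer_measure_of M (C + V))"

end

theory Submission
  imports Defs
begin

text \<open>
  Let \<open>f\<close> be admissible and \<open>I = Re (\<integral>f)\<close>. When \<open>I > 0\<close>, the only case with content, the claim is that the density of \<open>\<Lambda>\<close> is at most
  \<open>f(0) / I\<close>.

  The reason is a Cauchy-Schwarz argument for the positive semidefinite form given by \<open>f\<close>. Test \<open>f\<close>
  against the measure \<open>\<phi> d\<mu> - b \<Sum>w\<in>F. \<delta>\<^sub>w\<close>, where \<open>F\<close> is a finite part of \<open>\<Lambda> \<inter> V\<close> and \<open>\<phi>\<close> is a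
  cut-off function that equals \<open>1\<close> on \<open>V\<close> and vanishes outside an open \<open>U\<close> containing \<open>C + V\<close>.
  Differences of distinct points of \<open>\<Lambda>\<close> lie outside \<open>\<Omega>\<close>, so \<open>F\<close> interacts with itself only on the
  diagonal and contributes \<open>b\<^sup>2 #F f(0)\<close>. If \<open>\<phi>\<close> is nearly constant at the scale on which \<open>f\<close>
  lives, then \<open>\<integral>\<phi>(x) f(x - w) dx\<close> is nearly \<open>\<phi>(w) \<integral>f\<close>. The cross terms are then about \<open>2 b #F I\<close>,
  and the square of \<open>\<phi> d\<mu>\<close> is at most about \<open>\<mu>(U) I\<close>. Optimising over \<open>b\<close> yields
  \<open>#F / \<mu>(U) \<le> f(0) / I\<close> up to an arbitrarily small error (\<open>packing_estimate\<close>).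

  The infimum over \<open>C\<close> in the density provides the room for \<open>\<phi>\<close>. If \<open>C\<close> is a \<open>k\<close>-fold sumset of a
  compact set \<open>K\<close> carrying almost all of \<open>\<bar>f\<bar>\<close>, then \<open>U\<close> can be eroded \<open>k\<close> times by \<open>K\<close> before \<open>V\<close> is
  reached, and averaging the indicators of these erosions gives a \<open>\<phi>\<close> that varies by at most
  \<open>1 / k\<close> under translation by \<open>K\<close> (\<open>plateau_function\<close>).

  Two points need care in a general group. The support of \<open>f\<close> is only closed; tightness of \<open>\<bar>f\<bar> d\<mu>\<close>
  (\<open>haar_integrable_tight\<close>) supplies \<open>K\<close>. And positive definiteness is a statement about finite sums,
  while double integrals of \<open>f(x - y)\<close> are problematic without second countability and
  \<open>\<sigma>\<close>-finiteness; therefore \<open>\<phi> d\<mu>\<close> is replaced by a finite point mass (\<open>discretise_integral\<close>), which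
  is accurate because positive definite continuous functions are uniformly continuous.
\<close>

section \<open>Positive definite functions\<close>

lemma positive_definite_finite_sum:
  fixes f :: "'a::ab_group_add \<Rightarrow> complex" and x :: "'i \<Rightarrow> 'a" and c :: "'i \<Rightarrow> complex"
  assumes "positive_definite_fun f" and "finite S"
  shows "(\<Sum>i\<in>S. \<Sum>j\<in>S. c i * cnj (c j) * f (x i - x j)) \<in> \<real>\<^sub>\<ge>\<^sub>0"
proof -
  obtain h where h: "bij_betw h {0..<card S} S"
    using ex_bij_betw_nat_finite[OF \<open>finite S\<close>] by blast
  have h': "bij_betw h {..<card S} S"
    using h by (simp add: atLeast0LessThan)
  have "(\<Sum>i\<in>S. \<Sum>j\<in>S. c i * cnj (c j) * f (x i - x j))
      = (\<Sum>n<card S. \<Sum>m<card S. c (h n) * cnj (c (h m)) * f (x (h n) - x (h m)))"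
    by (simp add: sum.reindex_bij_betw[OF h', symmetric])
  then show ?thesis
    using assms(1)[unfolded positive_definite_fun_def, rule_format,
        where N="card S" and x="x \<circ> h" and c="c \<circ> h"]
    by simp
qed

text \<open>
  The points \<open>0\<close> and \<open>x\<close> with weights \<open>1\<close> and \<open>c\<close>. The choices \<open>c = 1\<close> and \<open>c = \<i>\<close> give the Hermitian
  symmetry of \<open>f\<close>, and rotating \<open>f x\<close> onto the negative half-axis gives \<open>\<bar>f x\<bar> \<le> f 0\<close>.
\<close>

lemma positive_definite_two_points:
  assumes "positive_definite_fun f"
  shows "f 0 + c * cnj c * f 0 + c * f x + cnj c * f (- x) \<in> \<real>\<^sub>\<ge>\<^sub>0"
  using positive_definite_finite_sum[OF assms, of "{0, 1::nat}" "\<lambda>n. if n = 0 then 1 else c"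
      "\<lambda>n. if n = 0 then 0 else x"]
  by (simp add: algebra_simps)

lemma positive_definite_zero:
  assumes "positive_definite_fun f"
  shows "Im (f 0) = 0" and "0 \<le> Re (f 0)"
  using positive_definite_two_points[OF assms, of 0]
  by (simp_all add: complex_nonneg_Reals_iff)

lemma positive_definite_minus:
  assumes "positive_definite_fun f"
  shows "f (- x) = cnj (f x)"
  using positive_definite_two_points[OF assms, of 1 x]
    positive_definite_two_points[OF assms, of \<i> x] positive_definite_zero[OF assms]
  by (simp add: complex_nonneg_Reals_iff complex_eq_iff)

lemma cnj_rotation:
  assumes "d \<noteq> 0"
  shows "cnj d / cmod d * d = cmod d" and "cnj d / cmod d * (d / cmod d) = 1"
proof -
  have "d * cnj d = of_real (cmod d) * of_real (cmod d)"
    by (metis complex_norm_square of_real_mult power2_eq_square)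
  then show "cnj d / cmod d * d = cmod d" "cnj d / cmod d * (d / cmod d) = 1"
    using assms by (simp_all add: mult.commute)
qed

lemma positive_definite_bounded:
  assumes "positive_definite_fun f"
  shows "cmod (f x) \<le> Re (f 0)"
proof (cases "f x = 0")
  case True
  then show ?thesis using positive_definite_zero[OF assms] by simp
next
  case False
  define c where "c = - cnj (f x) / cmod (f x)"
  have 1: "c * f x = - cmod (f x)"
    using cnj_rotation(1)[OF False] by (simp add: c_def)
  have 2: "cnj c * f (- x) = - cmod (f x)"
    using arg_cong[OF 1, of cnj] by (simp add: positive_definite_minus[OF assms])
  have 3: "c * cnj c = 1"
    using cnj_rotation(2)[OF False] by (simp add: c_def)
  show ?thesis
    using positive_definite_two_points[OF assms, of c x] unfolding 1 2 3
    by (simp add: complex_nonneg_Reals_iff)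
qed

text \<open>
  Krein's inequality. The test points \<open>0\<close>, \<open>x\<close>, \<open>y\<close> with weights \<open>1\<close>, \<open>t\<close>, \<open>-t\<close> make the increment
  \<open>f x - f y\<close> appear linearly in \<open>t\<close> and \<open>f 0 - Re (f (x - y))\<close> quadratically. Optimising over \<open>t\<close>
  bounds all increments of \<open>f\<close> by its behaviour at the single point \<open>0\<close>.
\<close>

lemma positive_definite_increment:
  assumes pd: "positive_definite_fun f"
  shows "(cmod (f x - f y))\<^sup>2 \<le> 2 * Re (f 0) * (Re (f 0) - Re (f (x - y)))"
proof (cases "f x = f y")
  case True
  have "Re (f (x - y)) \<le> Re (f 0)"
    using positive_definite_bounded[OF pd, of "x - y"] complex_Re_le_cmod[of "f (x - y)"] by simp
  then show ?thesis using positive_definite_zero[OF pd] True by simp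
next
  case False
  define d where "d = f x - f y"
  have d: "cmod d > 0" using False by (simp add: d_def)
  \<comment> \<open>The phase of \<open>t\<close> turns \<open>t * d\<close> into a negative real; the modulus \<open>r\<close> minimises the quadratic.\<close>
  define r where "r = Re (f 0) / cmod d"
  define t where "t = - (r * (cnj d / cmod d))"
  have t1: "t * d = - (r * cmod d)"
  proof -
    have "t * d = - (r * (cnj d / cmod d * d))"
      by (simp add: t_def)
    also have "\<dots> = - (r * cmod d)" using d by (subst cnj_rotation(1)) auto
    finally show ?thesis .
  qed
  have t2: "t * cnj t = r\<^sup>2"
  proof -
    have "t * cnj t = r\<^sup>2 * (cnj d / cmod d * (d / cmod d))"
      by (simp add: t_def power2_eq_square)
    also have "\<dots> = r\<^sup>2" using d by (subst cnj_rotation(2)) auto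
    finally show ?thesis .
  qed
  have sum: "f 0 + t * f x - t * f y + cnj t * f (- x) - cnj t * f (- y)
      + t * cnj t * (2 * f 0 - f (x - y) - f (y - x)) \<in> \<real>\<^sub>\<ge>\<^sub>0"
    using positive_definite_finite_sum[OF pd, of "{0, 1, 2::nat}"
        "\<lambda>n. if n = 0 then 1 else if n = 1 then t else - t"
        "\<lambda>n. if n = 0 then 0 else if n = 1 then x else y"]
    by (simp add: algebra_simps)
  have "cnj t * f (- x) - cnj t * f (- y) = cnj (t * d)"
    by (simp add: positive_definite_minus[OF pd] d_def algebra_simps)
  moreover have "f (y - x) = cnj (f (x - y))"
    using positive_definite_minus[OF pd, of "x - y"] by simp
  moreover have "t * f x - t * f y = t * d" by (simp add: d_def algebra_simps)
  ultimately have "f 0 + t * d + cnj (t * d)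
      + t * cnj t * (2 * f 0 - f (x - y) - cnj (f (x - y))) \<in> \<real>\<^sub>\<ge>\<^sub>0"
    using sum by (simp add: algebra_simps)
  then have "0 \<le> Re (f 0) - 2 * (r * cmod d) + r\<^sup>2 * (2 * Re (f 0) - 2 * Re (f (x - y)))"
    unfolding t1 t2 by (simp add: complex_nonneg_Reals_iff power2_eq_square algebra_simps)
  moreover have "r * cmod d = Re (f 0)" using d by (simp add: r_def)
  ultimately have *: "Re (f 0) \<le> 2 * r\<^sup>2 * (Re (f 0) - Re (f (x - y)))"
    by (simp add: algebra_simps)
  have "Re (f 0) > 0"
  proof (rule ccontr)
    assume "\<not> Re (f 0) > 0"
    then have "f x = 0" "f y = 0"
      using positive_definite_bounded[OF pd, of x] positive_definite_bounded[OF pd, of y]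
      by (smt (verit) zero_less_norm_iff)+
    then show False using False by simp
  qed
  have "Re (f 0) * (cmod d)\<^sup>2 \<le> 2 * (r * cmod d)\<^sup>2 * (Re (f 0) - Re (f (x - y)))"
    using mult_right_mono[OF *, of "(cmod d)\<^sup>2"] by (simp add: power_mult_distrib algebra_simps)
  then have "Re (f 0) * (cmod d)\<^sup>2 \<le> Re (f 0) * (2 * Re (f 0) * (Re (f 0) - Re (f (x - y))))"
    using \<open>r * cmod d = Re (f 0)\<close> by (simp add: power2_eq_square algebra_simps)
  then show ?thesis using \<open>Re (f 0) > 0\<close> by (simp add: d_def)
qed

text \<open>
  Continuity at \<open>0\<close> alone makes the right-hand side of Krein's inequality small, uniformly in the
  base point. This replaces compactness of the support of \<open>f\<close> in the discretisation below.
\<close>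

lemma positive_definite_uniformly_continuous:
  fixes f :: "'a::topological_ab_group_add \<Rightarrow> complex"
  assumes pd: "positive_definite_fun f" and cont: "continuous_on UNIV f" and "e > 0"
  obtains N where "open N" "0 \<in> N" "\<forall>x y. x - y \<in> N \<longrightarrow> cmod (f x - f y) \<le> e"
proof
  let ?N = "{z. 2 * Re (f 0) * (Re (f 0) - Re (f z)) < e\<^sup>2}"
  show "open ?N"
    by (intro open_Collect_less continuous_intros cont)
  show "0 \<in> ?N" using \<open>e > 0\<close> by simp
  show "\<forall>x y. x - y \<in> ?N \<longrightarrow> cmod (f x - f y) \<le> e"
  proof (intro allI impI, rule power2_le_imp_le)
    fix x y assume that: "x - y \<in> ?N"
    show "(cmod (f x - f y))\<^sup>2 \<le> e\<^sup>2"
      using positive_definite_increment[OF pd, of x y] that by simp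
  qed (use \<open>e > 0\<close> in simp)
qed

section \<open>Translation invariance and tightness of the Haar measure\<close>

lemma haar_measureD:
  assumes "haar_measure M"
  shows sets_haar: "sets M = sets borel"
    and space_haar: "space M = UNIV"
    and haar_compact_finite: "compact K \<Longrightarrow> emeasure M K < \<infinity>"
    and haar_translate: "B \<in> sets borel \<Longrightarrow> emeasure M ((+) a ` B) = emeasure M B"
    and haar_outer_regular:
      "B \<in> sets borel \<Longrightarrow> emeasure M B = (INF U \<in> {U. open U \<and> B \<subseteq> U}. emeasure M U)"
    and haar_inner_regular:
      "open U \<Longrightarrow> emeasure M U = (SUP K \<in> {K. compact K \<and> K \<subseteq> U}. emeasure M K)"
proof -
  note M = assms[unfolded haar_measure_def]
  show "sets M = sets borel" using M by (elim conjE)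
  from sets_eq_imp_space_eq[OF this] show "space M = UNIV" by simp
  show "compact K \<Longrightarrow> emeasure M K < \<infinity>"
    by (rule M[THEN conjunct2, THEN conjunct2, THEN conjunct1, rule_format])
  show "B \<in> sets borel \<Longrightarrow> emeasure M ((+) a ` B) = emeasure M B"
    by (rule M[THEN conjunct2, THEN conjunct2, THEN conjunct2, THEN conjunct1, rule_format])
  show "B \<in> sets borel \<Longrightarrow> emeasure M B = (INF U \<in> {U. open U \<and> B \<subseteq> U}. emeasure M U)"
    by (rule M[THEN conjunct2, THEN conjunct2, THEN conjunct2, THEN conjunct2, THEN conjunct1, rule_format])
  show "open U \<Longrightarrow> emeasure M U = (SUP K \<in> {K. compact K \<and> K \<subseteq> U}. emeasure M K)"
    by (rule M[THEN conjunct2, THEN conjunct2, THEN conjunct2, THEN conjunct2, THEN conjunct2, rule_format])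
qed

lemma distr_haar_translate:
  fixes M :: "'a::{topological_ab_group_add, t2_space} measure"
  assumes M: "haar_measure M"
  shows "distr M M (\<lambda>x. x - a) = M"
proof (rule measure_eqI)
  fix A assume "A \<in> sets (distr M M (\<lambda>x. x - a))"
  then have A: "A \<in> sets borel" by (simp add: sets_haar[OF M])
  have meas: "(\<lambda>x. x - a) \<in> measurable M M"
    unfolding measurable_cong_sets[OF sets_haar[OF M] sets_haar[OF M]]
    by (intro borel_measurable_continuous_onI continuous_intros)
  have "(\<lambda>x. x - a) -` A = (+) a ` A"
    by (auto simp: image_iff) (metis add_diff_cancel_left' add.commute diff_add_cancel)
  then show "emeasure (distr M M (\<lambda>x. x - a)) A = emeasure M A"
    using A by (simp add: emeasure_distr[OF meas] sets_haar[OF M] space_haar[OF M] haar_translate[OF M])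
qed simp

lemma integrable_haar_translate:
  fixes M :: "'a::{topological_ab_group_add, t2_space} measure"
    and f :: "'a \<Rightarrow> 'b::{banach, second_countable_topology}"
  assumes M: "haar_measure M" and f: "integrable M f"
  shows "integrable M (\<lambda>x. f (x - a))" and "(\<integral>x. f (x - a) \<partial>M) = (\<integral>x. f x \<partial>M)"
proof -
  have meas: "(\<lambda>x. x - a) \<in> measurable M M"
    unfolding measurable_cong_sets[OF sets_haar[OF M] sets_haar[OF M]]
    by (intro borel_measurable_continuous_onI continuous_intros)
  show "integrable M (\<lambda>x. f (x - a))"
    by (rule integrable_distr[OF meas]) (simp add: distr_haar_translate[OF M] f)
  show "(\<integral>x. f (x - a) \<partial>M) = (\<integral>x. f x \<partial>M)"
    using integral_distr[OF meas borel_measurable_integrable[OF f]]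
    by (simp add: distr_haar_translate[OF M])
qed

text \<open>
  The measure may fail to be \<open>\<sigma>\<close>-finite, yet one integrable function lives, up to \<open>\<delta>\<close>, on a compact
  set. The sets \<open>\<bar>f\<bar> > 1 / (n + 1)\<close> are open and, by Markov's inequality, of finite measure; they carry
  almost all of the integral for large \<open>n\<close>. Inner regularity then exhausts one of them by a compact
  set, and since \<open>f\<close> is bounded the part of small measure that is lost costs little.
\<close>

lemma haar_integrable_tight:
  fixes f :: "'a::{topological_ab_group_add, t2_space} \<Rightarrow> complex"
  assumes M: "haar_measure M" and f: "integrable M f" "continuous_on UNIV f"
    and bound: "\<And>x. cmod (f x) \<le> B" and "\<delta> > 0"
  obtains K where "compact K" "(\<integral>x. cmod (f x) * indicator (- K) x \<partial>M) \<le> \<delta>"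
proof -
  define S where "S n = {x. cmod (f x) > 1 / Suc n}" for n
  have S: "open (S n)" for n
    unfolding S_def by (intro open_Collect_less continuous_intros f)
  have Sm: "S n \<in> sets M" for n using S by (simp add: sets_haar[OF M])
  have fm: "f \<in> borel_measurable M" using f(1) by auto
  have fin: "emeasure M (S n) < \<infinity>" for n
  proof -
    have "emeasure M (S n) \<le> emeasure M {x \<in> space M. cmod (f x) \<ge> 1 / Suc n}"
    proof (rule emeasure_mono)
      show "S n \<subseteq> {x \<in> space M. cmod (f x) \<ge> 1 / Suc n}"
        unfolding S_def space_haar[OF M] by (intro Collect_mono) simp
      show "{x \<in> space M. cmod (f x) \<ge> 1 / Suc n} \<in> sets M"
        using fm by measurable
    qed
    also have "\<dots> \<le> (1 / (1 / Suc n)) * (\<integral>x. cmod (f x) \<partial>M)"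
      using f(1) by (intro integral_Markov_inequality) auto
    also have "\<dots> < \<infinity>" by simp
    finally show ?thesis .
  qed
  have "(\<lambda>n. \<integral>x. cmod (f x) * indicator (- S n) x \<partial>M) \<longlonglongrightarrow> (\<integral>x. 0 \<partial>M)"
  proof (rule integral_dominated_convergence[where w="\<lambda>x. cmod (f x)"])
    show "AE x in M. (\<lambda>n. cmod (f x) * indicator (- S n) x) \<longlonglongrightarrow> 0"
    proof (rule AE_I2)
      fix x
      show "(\<lambda>n. cmod (f x) * indicator (- S n) x) \<longlonglongrightarrow> 0"
      proof (rule Lim_null_comparison[OF _ LIMSEQ_inverse_real_of_nat])
        show "\<forall>\<^sub>F n in sequentially. norm (cmod (f x) * indicator (- S n) x) \<le> inverse (real (Suc n))"
          by (auto simp: S_def indicator_def not_less divide_inverse intro!: always_eventually)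
      qed
    qed
  qed (use f(1) fm Sm in \<open>auto simp: indicator_def\<close>)
  then have "\<forall>\<^sub>F n in sequentially. (\<integral>x. cmod (f x) * indicator (- S n) x \<partial>M) < \<delta> / 2"
    using \<open>\<delta> > 0\<close> by (intro order_tendstoD(2)[of _ 0]) auto
  then obtain n where n: "(\<integral>x. cmod (f x) * indicator (- S n) x \<partial>M) < \<delta> / 2"
    using eventually_happens'[OF sequentially_bot] by blast
  have B: "B \<ge> 0" by (rule order_trans[OF norm_ge_zero bound])
  define \<eta> where "\<eta> = \<delta> / (2 * (B + 1))"
  have \<eta>: "\<eta> > 0" using B \<open>\<delta> > 0\<close> by (simp add: \<eta>_def)
  have "\<exists>K. compact K \<and> K \<subseteq> S n \<and> emeasure M (S n) < emeasure M K + ennreal \<eta>"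
  proof (cases "emeasure M (S n) = 0")
    case True
    then show ?thesis using \<eta> by (intro exI[of _ "{}"]) auto
  next
    case False
    then have "emeasure M (S n) - ennreal \<eta> < emeasure M (S n)"
      using fin[of n] \<eta> by (intro ennreal_between) (auto simp: zero_less_iff_neq_zero)
    then obtain K where "compact K" "K \<subseteq> S n" "emeasure M (S n) - ennreal \<eta> < emeasure M K"
      using haar_inner_regular[OF M S, of n] by (auto simp: less_SUP_iff)
    moreover have "emeasure M K \<le> emeasure M (S n) - ennreal \<eta>"
      if "emeasure M K + ennreal \<eta> \<le> emeasure M (S n)"
      using ennreal_minus_mono[OF that order_refl, of "ennreal \<eta>"] by simp
    ultimately show ?thesis by (meson not_le)
  qed
  then obtain K where K: "compact K" "K \<subseteq> S n" "emeasure M (S n) < emeasure M K + ennreal \<eta>"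
    by blast
  have Km: "K \<in> sets M" using K(1) by (simp add: sets_haar[OF M] compact_imp_closed)
  have Kfin: "emeasure M K < \<infinity>" using haar_compact_finite[OF M K(1)] .
  have "measure M (S n) \<le> measure M K + \<eta>"
    using K(3) fin[of n] Kfin \<eta>
    by (simp add: emeasure_eq_ennreal_measure less_top ennreal_less_iff ennreal_plus[symmetric] del: ennreal_plus)
  then have diff: "measure M (S n - K) \<le> \<eta>"
    using fin[of n] Km Sm K(2) by (subst measure_Diff) auto
  have dfin: "emeasure M (S n - K) < \<infinity>"
    using fin[of n] Sm by (meson Diff_subset emeasure_mono order_le_less_trans)
  have i1: "integrable M (\<lambda>x. cmod (f x) * indicator (- S n) x)"
    using f(1) S by (intro integrable_real_mult_indicator) (auto simp: sets_haar[OF M])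
  show ?thesis
  proof (rule that[OF K(1)])
    have "(\<integral>x. cmod (f x) * indicator (- K) x \<partial>M)
        \<le> (\<integral>x. cmod (f x) * indicator (- S n) x + B * indicator (S n - K) x \<partial>M)"
    proof (rule integral_mono')
      show "integrable M (\<lambda>x. cmod (f x) * indicator (- S n) x + B * indicator (S n - K) x)"
        using i1 Sm Km dfin by (intro Bochner_Integration.integrable_add integrable_mult_right) auto
    qed (use bound B K(2) in \<open>auto simp: indicator_def\<close>)
    also have "\<dots> = (\<integral>x. cmod (f x) * indicator (- S n) x \<partial>M) + B * measure M (S n - K)"
      using i1 Sm Km dfin by (subst Bochner_Integration.integral_add) auto
    also have "\<dots> \<le> \<delta> / 2 + B * \<eta>"
      using n diff B by (intro add_mono mult_left_mono) auto
    also have "B * \<eta> \<le> \<delta> / 2"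
      using B \<open>\<delta> > 0\<close> by (simp add: \<eta>_def field_simps)
    finally show "(\<integral>x. cmod (f x) * indicator (- K) x \<partial>M) \<le> \<delta>" by simp
  qed
qed

section \<open>Slowly varying plateau functions\<close>

lemma compact_set_plus:
  fixes A B :: "'a::topological_ab_group_add set"
  assumes "compact A" "compact B"
  shows "compact (A + B)"
proof -
  have "A + B = (\<lambda>p. fst p + snd p) ` (A \<times> B)"
    by (fastforce simp: set_plus_def image_iff)
  moreover have "compact ((\<lambda>p. fst p + snd p) ` (A \<times> B))"
    using assms by (intro compact_continuous_image compact_Times continuous_intros)
  ultimately show ?thesis by simp
qed

lemma compact_iterated_sumset:
  fixes K :: "'a::topological_ab_group_add set"
  assumes "compact K"
  shows "compact (\<Sum>j<(n::nat). K)"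
  by (induction n) (simp_all add: set_zero compact_set_plus assms)

lemma iterated_sumset_mono:
  fixes K :: "'a::topological_ab_group_add set"
  assumes "0 \<in> K" and "i \<le> (k::nat)"
  shows "(\<Sum>j<i. K) \<subseteq> (\<Sum>j<k. K)"
proof (rule lift_Suc_mono_le[OF _ \<open>i \<le> k\<close>])
  fix n
  show "(\<Sum>j<n. K) \<subseteq> (\<Sum>j<Suc n. K)"
  proof
    fix x assume "x \<in> (\<Sum>j<n. K)"
    then have "x + 0 \<in> (\<Sum>j<n. K) + K" using \<open>0 \<in> K\<close> by (rule set_plus_intro)
    then show "x \<in> (\<Sum>j<Suc n. K)" by simp
  qed
qed

text \<open>
  Each point of the erosion of \<open>U\<close> by a compact \<open>C\<close> has a neighbourhood in it by the tube lemma.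
  Openness is what makes plateau functions measurable although \<open>U\<close> contains a Minkowski sum that
  may be non-measurable.
\<close>

lemma open_erosion:
  fixes U C :: "'a::topological_ab_group_add set"
  assumes "open U" "compact C"
  shows "open {x. \<forall>c\<in>C. x + c \<in> U}"
proof (subst open_subopen, safe)
  fix x assume x: "\<forall>c\<in>C. x + c \<in> U"
  have "open ((\<lambda>p. fst p + snd p) -` U :: ('a \<times> 'a) set)"
    using \<open>open U\<close> by (intro open_vimage continuous_intros)
  moreover have "{x} \<times> C \<subseteq> (\<lambda>p. fst p + snd p) -` U" using x by auto
  ultimately have "\<exists>X. x \<in> X \<and> open X \<and> X \<times> C \<subseteq> (\<lambda>p. fst p + snd p) -` U"
    by (rule Elementary_Topology.tube_lemma[OF \<open>compact C\<close>])
  then obtain X where "x \<in> X" "open X" "X \<times> C \<subseteq> (\<lambda>p. fst p + snd p) -` U"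
    by (elim exE conjE)
  then show "\<exists>T. open T \<and> x \<in> T \<and> T \<subseteq> {x. \<forall>c\<in>C. x + c \<in> U}"
    by (intro exI[of _ X]) auto
qed

text \<open>
  The average of the indicators of the successive erosions of \<open>U\<close> by the \<open>i\<close>-fold sumsets of \<open>K\<close>,
  \<open>i < k\<close>. A step by an element of \<open>K\<close> moves a point at most one erosion level up or down, so \<open>\<phi>\<close>
  changes by at most \<open>1 / k\<close>. This gives a slowly varying cut-off on any open set with enough room,
  and takes the place of a Folner sequence.
\<close>

lemma plateau_function:
  fixes U K :: "'a::topological_ab_group_add set"
  assumes "open U" "compact K" "0 \<in> K" "k > 0"
  obtains \<phi> :: "'a \<Rightarrow> real" where
    "\<phi> \<in> borel_measurable borel" "\<And>x. 0 \<le> \<phi> x" "\<And>x. \<phi> x \<le> 1"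
    "\<And>x. x \<notin> U \<Longrightarrow> \<phi> x = 0"
    "\<And>x. \<forall>c\<in>(\<Sum>j<k. K). x + c \<in> U \<Longrightarrow> \<phi> x = 1"
    "\<And>x y. x - y \<in> K \<Longrightarrow> y - x \<in> K \<Longrightarrow> \<bar>\<phi> x - \<phi> y\<bar> \<le> 1 / real k"
proof
  define E where "E i = {x. \<forall>c\<in>(\<Sum>j<i. K). x + c \<in> U}" for i :: nat
  define \<phi> where "\<phi> x = (\<Sum>i<k. indicator (E i) x) / real k" for x
  have E: "open (E i)" for i
    unfolding E_def by (intro open_erosion compact_iterated_sumset assms)
  have sum_le: "(\<Sum>i<n. indicator (E i) x) \<le> real n" for n x
  proof -
    have "(\<Sum>i<n. indicator (E i) x) \<le> (\<Sum>i<n. 1::real)"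
      by (intro sum_mono) (auto simp: indicator_def)
    then show ?thesis by simp
  qed
  show "\<phi> \<in> borel_measurable borel"
    unfolding \<phi>_def using E by (intro borel_measurable_divide borel_measurable_sum
        borel_measurable_indicator borel_measurable_const) auto
  show "0 \<le> \<phi> x" for x by (simp add: \<phi>_def sum_nonneg)
  show "\<phi> x \<le> 1" for x using sum_le[where n=k and x=x] \<open>k > 0\<close> by (simp add: \<phi>_def)
  show "\<phi> x = 0" if "x \<notin> U" for x
  proof -
    have "0 \<in> (\<Sum>j<i. K)" for i :: nat
      using iterated_sumset_mono[OF \<open>0 \<in> K\<close>, of 0 i] by (simp add: set_zero)
    then have "x \<notin> E i" for i using that by (auto simp: E_def intro!: bexI[of _ 0])
    then show ?thesis by (simp add: \<phi>_def)
  qed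
  show "\<phi> x = 1" if inside: "\<forall>c\<in>(\<Sum>j<k. K). x + c \<in> U" for x
  proof -
    have "x \<in> E i" if "i < k" for i
      using inside iterated_sumset_mono[OF \<open>0 \<in> K\<close>, of i k] that by (auto simp: E_def)
    then show ?thesis using \<open>k > 0\<close> by (simp add: \<phi>_def)
  qed
  have one_sided: "\<phi> x - \<phi> y \<le> 1 / real k" if "y - x \<in> K" for x y
  proof -
    obtain m where m: "k = Suc m" using \<open>k > 0\<close> by (cases k) auto
    \<comment> \<open>A step of length one in \<open>K\<close> costs one level of erosion.\<close>
    have step: "y \<in> E i" if "x \<in> E (Suc i)" for i
    proof -
      have "y + c \<in> U" if "c \<in> (\<Sum>j<i. K)" for c
      proof -
        have "c + (y - x) \<in> (\<Sum>j<Suc i. K)"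
          using that \<open>y - x \<in> K\<close> by (simp add: set_plus_intro)
        then have "x + (c + (y - x)) \<in> U" using \<open>x \<in> E (Suc i)\<close> unfolding E_def by blast
        then show ?thesis by (simp add: algebra_simps)
      qed
      then show ?thesis by (simp add: E_def)
    qed
    have "(\<Sum>i<k. indicator (E i) x) = indicator (E 0) x + (\<Sum>i<m. indicator (E (Suc i)) x :: real)"
      unfolding m by (rule sum.lessThan_Suc_shift)
    also have "\<dots> \<le> 1 + (\<Sum>i<m. indicator (E i) y)"
      using step by (intro add_mono sum_mono) (auto simp: indicator_def)
    also have "\<dots> \<le> 1 + (\<Sum>i<k. indicator (E i) y)"
      unfolding m by simp
    finally have "(\<Sum>i<k. indicator (E i) x) - (\<Sum>i<k. indicator (E i) y) \<le> (1::real)" by simp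
    then show ?thesis
      using \<open>k > 0\<close> by (simp add: \<phi>_def diff_divide_distrib[symmetric] divide_right_mono)
  qed
  show "\<bar>\<phi> x - \<phi> y\<bar> \<le> 1 / real k" if "x - y \<in> K" "y - x \<in> K" for x y
    using one_sided[of y x] one_sided[of x y] that by simp
qed

text \<open>
  Averaging \<open>f\<close> around \<open>z\<close> against a slowly varying \<open>\<phi>\<close> is nearly multiplication of \<open>\<integral>f\<close> by \<open>\<phi> z\<close>: on
  \<open>K\<close> the variation of \<open>\<phi>\<close> is at most \<open>r\<close>, and off \<open>K\<close> only the tail of \<open>f\<close> contributes. The estimate
  is uniform in \<open>z\<close>.
\<close>

lemma plateau_average:
  fixes M :: "'a::{topological_ab_group_add, t2_space} measure" and f :: "'a \<Rightarrow> complex"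
  assumes M: "haar_measure M" and f: "integrable M f" and K: "K \<in> sets M"
    and \<phi>: "\<phi> \<in> borel_measurable M" "\<And>x. 0 \<le> \<phi> x" "\<And>x. \<phi> x \<le> (1::real)"
    and slow: "\<And>x y. x - y \<in> K \<Longrightarrow> \<bar>\<phi> x - \<phi> y\<bar> \<le> r" and "0 \<le> r"
  shows "integrable M (\<lambda>x. \<phi> x * f (x - z))"
    and "cmod ((\<integral>x. \<phi> x * f (x - z) \<partial>M) - \<phi> z * (\<integral>x. f x \<partial>M))
      \<le> r * (\<integral>x. cmod (f x) \<partial>M) + (\<integral>x. cmod (f x) * indicator (- K) x \<partial>M)"
proof -
  have fz: "integrable M (\<lambda>x. f (x - z))"
    by (rule integrable_haar_translate(1)[OF M f])
  show i1: "integrable M (\<lambda>x. \<phi> x * f (x - z))"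
  proof (rule Bochner_Integration.integrable_bound[OF fz])
    show "(\<lambda>x. \<phi> x * f (x - z)) \<in> borel_measurable M"
      using \<phi>(1) borel_measurable_integrable[OF fz] by measurable
    show "AE x in M. norm (\<phi> x * f (x - z)) \<le> norm (f (x - z))"
      using \<phi>(2,3) by (intro AE_I2) (simp add: norm_mult mult_left_le_one_le)
  qed
  define g where "g x = r * cmod (f x) + cmod (f x) * indicator (- K) x" for x
  have tail: "integrable M (\<lambda>x. cmod (f x) * indicator (- K) x)"
    using f sets.compl_sets[OF K]
    by (intro integrable_real_mult_indicator) (auto simp: space_haar[OF M] Compl_eq_Diff_UNIV)
  have g: "integrable M g" unfolding g_def using f tail by auto
  have "(\<integral>x. \<phi> x * f (x - z) \<partial>M) - \<phi> z * (\<integral>x. f x \<partial>M)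
      = (\<integral>x. (\<phi> x - \<phi> z) * f (x - z) \<partial>M)"
    using i1 fz by (simp add: integrable_haar_translate(2)[OF M f, of z, symmetric] left_diff_distrib)
  moreover have "cmod (\<integral>x. (\<phi> x - \<phi> z) * f (x - z) \<partial>M) \<le> (\<integral>x. g (x - z) \<partial>M)"
  proof (rule order_trans[OF integral_norm_bound integral_mono])
    show "integrable M (\<lambda>x. norm ((\<phi> x - \<phi> z) * f (x - z)))"
      using i1 fz by (intro integrable_norm) (simp add: left_diff_distrib)
    show "integrable M (\<lambda>x. g (x - z))" by (rule integrable_haar_translate(1)[OF M g])
    show "norm ((\<phi> x - \<phi> z) * f (x - z)) \<le> g (x - z)" for x
    proof (cases "x - z \<in> K")
      case True
      then show ?thesis
        using slow[of x z] by (simp add: g_def norm_mult mult_right_mono flip: of_real_diff)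
    next
      case False
      have "\<bar>\<phi> x - \<phi> z\<bar> \<le> 1" using \<phi>(2,3)[of x] \<phi>(2,3)[of z] by linarith
      then have "\<bar>\<phi> x - \<phi> z\<bar> * cmod (f (x - z)) \<le> 1 * cmod (f (x - z))"
        by (rule mult_right_mono) simp
      moreover have "0 \<le> r * cmod (f (x - z))" using \<open>0 \<le> r\<close> by simp
      ultimately show ?thesis
        using False by (simp add: g_def norm_mult flip: of_real_diff)
    qed
  qed
  moreover have "(\<integral>x. g (x - z) \<partial>M)
      = r * (\<integral>x. cmod (f x) \<partial>M) + (\<integral>x. cmod (f x) * indicator (- K) x \<partial>M)"
    unfolding integrable_haar_translate(2)[OF M g] unfolding g_def
    using f tail by (subst Bochner_Integration.integral_add) auto
  ultimately show "cmod ((\<integral>x. \<phi> x * f (x - z) \<partial>M) - \<phi> z * (\<integral>x. f x \<partial>M))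
      \<le> r * (\<integral>x. cmod (f x) \<partial>M) + (\<integral>x. cmod (f x) * indicator (- K) x \<partial>M)"
    by simp
qed

section \<open>Discretising an integral over a compact set\<close>

lemma finite_disjoint_refinement:
  assumes "finite Z" and "\<And>z. z \<in> Z \<Longrightarrow> B z \<in> sets M"
  shows "\<exists>A. (\<forall>z\<in>Z. A z \<in> sets M \<and> A z \<subseteq> B z) \<and> disjoint_family_on A Z \<and> (\<Union>z\<in>Z. A z) = (\<Union>z\<in>Z. B z)"
  using assms
proof (induction Z rule: finite_induct)
  case empty
  then show ?case by (auto simp: disjoint_family_on_def)
next
  case (insert w Z)
  then obtain A where A: "\<forall>z\<in>Z. A z \<in> sets M \<and> A z \<subseteq> B z" "disjoint_family_on A Z"
    "(\<Union>z\<in>Z. A z) = (\<Union>z\<in>Z. B z)" by auto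
  define A' where "A' = A(w := B w - (\<Union>z\<in>Z. A z))"
  have eq: "A' z = A z" if "z \<in> Z" for z using that insert.hyps by (auto simp: A'_def)
  have w: "A' w = B w - (\<Union>z\<in>Z. A z)" by (simp add: A'_def)
  have "\<forall>z\<in>insert w Z. A' z \<in> sets M \<and> A' z \<subseteq> B z"
    using A(1) eq w insert by (auto intro!: sets.Diff sets.finite_UN)
  moreover have "disjoint_family_on A' (insert w Z)"
    using A(2) eq w unfolding disjoint_family_on_def by auto
  moreover have "(\<Union>z\<in>insert w Z. A' z) = (\<Union>z\<in>insert w Z. B z)"
    using A(3) eq w by auto
  ultimately show ?case by blast
qed

text \<open>
  A finite weighted point set that reproduces \<open>\<integral>\<phi> h\<close> for all functions \<open>h\<close> of small oscillation at
  scale \<open>N\<close> at once: the weights are the \<open>\<phi>\<close>-masses of a finite Borel partition into pieces of size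
  \<open>N\<close>. Positive definiteness speaks about finite sums, so this is its passage to integrals. It avoids
  product measures, for which \<open>f (x - y)\<close> may fail to be jointly measurable when \<open>'a\<close> is not second
  countable, and for which Fubini's theorem may fail without \<open>\<sigma>\<close>-finiteness.
\<close>

lemma discretise_integral:
  fixes M :: "'a::topological_ab_group_add measure" and \<phi> :: "'a \<Rightarrow> real"
  assumes M: "sets M = sets borel" and \<phi>: "integrable M \<phi>" "\<And>x. 0 \<le> \<phi> x"
    and P: "compact P" "\<And>x. x \<notin> P \<Longrightarrow> \<phi> x = 0" and N: "open N" "0 \<in> N"
  obtains Z c where "finite Z" "\<forall>z. 0 \<le> c z" "(\<Sum>z\<in>Z. c z) = (\<integral>x. \<phi> x \<partial>M)"
    "\<forall>(h :: 'a \<Rightarrow> complex) \<epsilon>. integrable M (\<lambda>x. \<phi> x * h x)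
      \<longrightarrow> (\<forall>x y. x - y \<in> N \<longrightarrow> cmod (h x - h y) \<le> \<epsilon>)
      \<longrightarrow> cmod ((\<Sum>z\<in>Z. c z * h z) - (\<integral>x. \<phi> x * h x \<partial>M)) \<le> \<epsilon> * (\<integral>x. \<phi> x \<partial>M)"
proof -
  define B where "B z = (\<lambda>x. x - z) -` N" for z
  have B: "open (B z)" for z
    unfolding B_def using N(1) by (intro open_vimage continuous_intros)
  have "P \<subseteq> (\<Union>z\<in>P. B z)" using N(2) by (auto simp: B_def)
  then obtain Z where Z: "finite Z" "P \<subseteq> (\<Union>z\<in>Z. B z)"
    by (metis compactE_image[OF P(1), of P B] B)
  have "B z \<in> sets M" for z using B by (simp add: M)
  from finite_disjoint_refinement[OF Z(1), of B M, OF this]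
  obtain A where A': "\<forall>z\<in>Z. A z \<in> sets M \<and> A z \<subseteq> B z" "disjoint_family_on A Z"
    "(\<Union>z\<in>Z. A z) = (\<Union>z\<in>Z. B z)" by blast
  then have A: "\<And>z. z \<in> Z \<Longrightarrow> A z \<in> sets M" "\<And>z. z \<in> Z \<Longrightarrow> A z \<subseteq> B z"
    "disjoint_family_on A Z" "(\<Union>z\<in>Z. A z) = (\<Union>z\<in>Z. B z)" by blast+
  define \<psi> where "\<psi> z x = \<phi> x * indicator (A z) x" for z x
  define c where "c z = (\<integral>x. \<psi> z x \<partial>M)" for z
  have \<psi>0: "0 \<le> \<psi> z x" for z x using \<phi>(2) by (simp add: \<psi>_def)
  have \<psi>i: "integrable M (\<psi> z)" if "z \<in> Z" for z
    unfolding \<psi>_def using \<phi>(1) A(1)[OF that] by (rule integrable_real_mult_indicator[rotated])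
  have \<phi>_sum: "\<phi> x = (\<Sum>z\<in>Z. \<psi> z x)" for x
  proof -
    have "(\<Sum>z\<in>Z. \<psi> z x) = \<phi> x * indicator (\<Union>z\<in>Z. A z) x"
      by (simp add: \<psi>_def sum_distrib_left indicator_UN_disjoint[OF Z(1) A(3)])
    also have "\<dots> = \<phi> x"
      using P(2)[of x] Z(2) A(4) by (cases "x \<in> P") (auto simp: indicator_def)
    finally show ?thesis by simp
  qed
  have c_sum: "(\<Sum>z\<in>Z. c z) = (\<integral>x. \<phi> x \<partial>M)"
    unfolding c_def \<phi>_sum using \<psi>i by (rule Bochner_Integration.integral_sum[symmetric])
  show ?thesis
  proof (rule that[OF Z(1) _ c_sum])
    show "\<forall>z. 0 \<le> c z" by (simp add: c_def \<psi>0)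
  next
    show "\<forall>(h :: 'a \<Rightarrow> complex) \<epsilon>. integrable M (\<lambda>x. \<phi> x * h x)
      \<longrightarrow> (\<forall>x y. x - y \<in> N \<longrightarrow> cmod (h x - h y) \<le> \<epsilon>)
      \<longrightarrow> cmod ((\<Sum>z\<in>Z. c z * h z) - (\<integral>x. \<phi> x * h x \<partial>M)) \<le> \<epsilon> * (\<integral>x. \<phi> x \<partial>M)"
    proof (intro allI impI)
      fix h :: "'a \<Rightarrow> complex" and \<epsilon>
      assume h: "integrable M (\<lambda>x. \<phi> x * h x)" and osc: "\<forall>x y. x - y \<in> N \<longrightarrow> cmod (h x - h y) \<le> \<epsilon>"
      have hi: "integrable M (\<lambda>x. \<psi> z x * h x)" if "z \<in> Z" for z
      proof -
        have "integrable M (\<lambda>x. indicator (A z) x *\<^sub>R (\<phi> x * h x))"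
          by (rule integrable_mult_indicator[OF A(1)[OF that] h])
        then show ?thesis by (simp add: \<psi>_def scaleR_conv_of_real mult_ac)
      qed
      have "(\<integral>x. \<phi> x * h x \<partial>M) = (\<integral>x. (\<Sum>z\<in>Z. \<psi> z x * h x) \<partial>M)"
        by (subst \<phi>_sum) (simp add: sum_distrib_right)
      also have "\<dots> = (\<Sum>z\<in>Z. \<integral>x. \<psi> z x * h x \<partial>M)"
        using hi by (rule Bochner_Integration.integral_sum)
      finally have "(\<Sum>z\<in>Z. c z * h z) - (\<integral>x. \<phi> x * h x \<partial>M)
          = (\<Sum>z\<in>Z. c z * h z - (\<integral>x. \<psi> z x * h x \<partial>M))"
        by (simp add: sum_subtractf)
      also have "cmod \<dots> \<le> (\<Sum>z\<in>Z. \<epsilon> * c z)"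
      proof (rule sum_norm_le)
        fix z assume z: "z \<in> Z"
        have i: "integrable M (\<lambda>x. complex_of_real (\<psi> z x))" using \<psi>i[OF z] by simp
        have "c z * h z - (\<integral>x. \<psi> z x * h x \<partial>M) = (\<integral>x. \<psi> z x * (h z - h x) \<partial>M)"
          using i hi[OF z] by (simp add: c_def right_diff_distrib)
        also have "cmod \<dots> \<le> (\<integral>x. \<epsilon> * \<psi> z x \<partial>M)"
        proof (rule order_trans[OF integral_norm_bound integral_mono])
          show "integrable M (\<lambda>x. norm (\<psi> z x * (h z - h x)))"
            using i hi[OF z] by (intro integrable_norm) (simp add: right_diff_distrib)
          show "integrable M (\<lambda>x. \<epsilon> * \<psi> z x)" using \<psi>i[OF z] by simp
          show "norm (\<psi> z x * (h z - h x)) \<le> \<epsilon> * \<psi> z x" for x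
          proof (cases "x \<in> A z")
            case True
            then have "cmod (h z - h x) \<le> \<epsilon>"
              using A(2)[OF z] osc[rule_format, of x z] by (auto simp: B_def norm_minus_commute)
            from mult_right_mono[OF this \<psi>0, of z x] show ?thesis
              using \<psi>0[of z x] by (simp add: norm_mult mult.commute)
          qed (simp add: \<psi>_def)
        qed
        finally show "cmod (c z * h z - (\<integral>x. \<psi> z x * h x \<partial>M)) \<le> \<epsilon> * c z"
          by (simp add: c_def)
      qed
      finally show "cmod ((\<Sum>z\<in>Z. c z * h z) - (\<integral>x. \<phi> x * h x \<partial>M)) \<le> \<epsilon> * (\<integral>x. \<phi> x \<partial>M)"
        by (simp add: sum_distrib_left[symmetric] c_sum)
    qed
  qed
qed

section \<open>The packing estimate\<close>

text \<open>
  The positive definiteness inequality for the signed point mass \<open>\<Sum>z\<in>Z. c z \<delta>\<^sub>z - b \<Sum>w\<in>F. \<delta>\<^sub>w\<close>. The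
  index set is the disjoint sum \<open>Z <+> F\<close>, which also covers points common to \<open>Z\<close> and \<open>F\<close>. On \<open>F\<close>
  only the diagonal survives.
\<close>

lemma positive_definite_test_sum:
  fixes f :: "'a::ab_group_add \<Rightarrow> complex" and c :: "'a \<Rightarrow> real" and b :: real
  assumes pd: "positive_definite_fun f" and "finite Z" "finite F"
    and off_diagonal: "\<And>x y. x \<in> F \<Longrightarrow> y \<in> F \<Longrightarrow> x \<noteq> y \<Longrightarrow> f (x - y) = 0"
  shows "0 \<le> (\<Sum>w\<in>Z. c w * Re (\<Sum>z\<in>Z. c z * f (z - w)))
    - 2 * b * (\<Sum>w\<in>F. Re (\<Sum>z\<in>Z. c z * f (z - w))) + b\<^sup>2 * card F * Re (f 0)"
proof -
  have sym: "Re (f (w - z)) = Re (f (z - w))" for z w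
    using positive_definite_minus[OF pd, of "z - w"] by simp
  define x where "x = case_sum (\<lambda>z::'a. z) (\<lambda>w::'a. w)"
  define d where "d = case_sum c (\<lambda>w::'a. - b)"
  have "0 \<le> Re (\<Sum>i\<in>Z <+> F. \<Sum>j\<in>Z <+> F. d i * cnj (d j) * f (x i - x j))"
    using positive_definite_finite_sum[OF pd, of "Z <+> F" "\<lambda>i. complex_of_real (d i)" x] assms(2,3)
    by (simp add: complex_nonneg_Reals_iff)
  also have "(\<Sum>i\<in>Z <+> F. \<Sum>j\<in>Z <+> F. d i * cnj (d j) * f (x i - x j))
      = (\<Sum>z\<in>Z. \<Sum>w\<in>Z. c z * c w * f (z - w)) - (\<Sum>z\<in>Z. \<Sum>w\<in>F. c z * b * f (z - w))
        - (\<Sum>w\<in>F. \<Sum>z\<in>Z. b * c z * f (w - z)) + (\<Sum>v\<in>F. \<Sum>w\<in>F. b * b * f (v - w))"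
    using assms(2,3) by (simp add: sum.Plus x_def d_def sum.distrib sum_negf sum_subtractf)
  also have "Re \<dots> = (\<Sum>z\<in>Z. \<Sum>w\<in>Z. c z * c w * Re (f (z - w)))
      - (\<Sum>z\<in>Z. \<Sum>w\<in>F. c z * b * Re (f (z - w)))
      - (\<Sum>w\<in>F. \<Sum>z\<in>Z. b * c z * Re (f (w - z))) + (\<Sum>v\<in>F. \<Sum>w\<in>F. b * b * Re (f (v - w)))"
    by (simp flip: of_real_mult)
  also have "(\<Sum>z\<in>Z. \<Sum>w\<in>Z. c z * c w * Re (f (z - w)))
      = (\<Sum>w\<in>Z. c w * Re (\<Sum>z\<in>Z. c z * f (z - w)))"
    by (subst sum.swap) (simp add: sum_distrib_left mult_ac)
  also have "(\<Sum>z\<in>Z. \<Sum>w\<in>F. c z * b * Re (f (z - w)))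
      = b * (\<Sum>w\<in>F. Re (\<Sum>z\<in>Z. c z * f (z - w)))"
    by (subst sum.swap) (simp add: sum_distrib_left mult_ac)
  also have "(\<Sum>w\<in>F. \<Sum>z\<in>Z. b * c z * Re (f (w - z)))
      = b * (\<Sum>w\<in>F. Re (\<Sum>z\<in>Z. c z * f (z - w)))"
    by (simp add: sum_distrib_left mult_ac sym[of _ "_ :: 'a"])
  also have "(\<Sum>v\<in>F. \<Sum>w\<in>F. b * b * Re (f (v - w))) = (\<Sum>v\<in>F. \<Sum>w\<in>F. if v = w then b\<^sup>2 * Re (f 0) else 0)"
    using off_diagonal by (intro sum.cong) (auto simp: power2_eq_square)
  also have "\<dots> = b\<^sup>2 * card F * Re (f 0)"
    using \<open>finite F\<close> by simp
  finally show ?thesis by simp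
qed

text \<open>
  The quantitative core. With \<open>I = Re (\<integral>f)\<close> and \<open>m = \<mu>(U)\<close>, take a plateau function \<open>\<phi>\<close> on \<open>U\<close> that
  equals \<open>1\<close> on \<open>F\<close>, discretise \<open>\<phi> d\<mu>\<close> to weights \<open>c\<close> on \<open>Z\<close>, and test \<open>f\<close> against
  \<open>\<Sum>z\<in>Z. c z \<delta>\<^sub>z - b \<Sum>w\<in>F. \<delta>\<^sub>w\<close>. Up to the error \<open>e\<close>, every sum \<open>\<Sum>z\<in>Z. c z f (z - w)\<close> is \<open>\<phi> w * \<integral>f\<close>,
  so the test reads \<open>0 \<le> m I - 2 b #F I + b\<^sup>2 #F f(0)\<close>, and \<open>b = I / f(0)\<close> gives \<open>#F I \<le> m f(0)\<close>.
  The set \<open>C\<close> depends only on \<open>f\<close> and \<open>e\<close>: it is a \<open>k\<close>-fold sumset that leaves room in \<open>U\<close> for \<open>k\<close>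
  erosions around \<open>V\<close>.
\<close>

lemma packing_estimate:
  fixes M :: "'a::{topological_ab_group_add, t2_space} measure" and f :: "'a \<Rightarrow> complex"
  assumes M: "haar_measure M" and pd: "positive_definite_fun f"
    and cont: "continuous_on UNIV f" and f: "integrable M f"
    and f0: "0 < Re (f 0)" and I: "0 < Re (\<integral>x. f x \<partial>M)" and "e > 0"
  obtains C where "compact C" "C \<noteq> {}"
    "\<forall>V U P F. open U \<and> C + V \<subseteq> U \<and> U \<subseteq> P \<and> compact P \<and> finite F \<and> F \<subseteq> V
      \<and> (\<forall>x\<in>F. \<forall>y\<in>F. x \<noteq> y \<longrightarrow> f (x - y) = 0)
      \<longrightarrow> card F * (Re (\<integral>x. f x \<partial>M) * (Re (\<integral>x. f x \<partial>M) - 2 * e))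
        \<le> measure M U * (Re (f 0) * (Re (\<integral>x. f x \<partial>M) + e))"
proof -
  define J where "J = (\<integral>x. f x \<partial>M)"
  define I where "I = Re J"
  have "I > 0" using I by (simp add: I_def J_def)
  define T where "T = (\<integral>x. cmod (f x) \<partial>M)"
  obtain K where K: "compact K" "(\<integral>x. cmod (f x) * indicator (- K) x \<partial>M) \<le> e / 4"
    using haar_integrable_tight[OF M f cont positive_definite_bounded[OF pd], of "e / 4"] \<open>e > 0\<close>
    by auto
  have Km: "K \<in> sets M" using K(1) by (simp add: sets_haar[OF M] compact_imp_closed)
  \<comment> \<open>Symmetrised so that a step in \<open>K\<close> can be undone, as \<open>plateau_function\<close> requires.\<close>
  define L where "L = insert 0 (K \<union> uminus ` K)"
  have L: "compact L" "0 \<in> L"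
    unfolding L_def using K(1)
    by (auto intro!: compact_insert compact_Un compact_continuous_image continuous_intros)
  obtain k0 :: nat where k0: "4 * T / e < real k0" using reals_Archimedean2 by blast
  define k where "k = Suc k0"
  have k: "k > 0" "T / k \<le> e / 4"
  proof -
    have "4 * T / e \<le> real k" using k0 by (simp add: k_def)
    then have "4 * T \<le> real k * e" using \<open>e > 0\<close> by (simp add: field_simps)
    then show "k > 0" "T / k \<le> e / 4" by (simp_all add: k_def field_simps)
  qed
  show ?thesis
  proof (rule that)
    show "compact (\<Sum>j<k. L)" by (rule compact_iterated_sumset[OF L(1)])
    show "(\<Sum>j<k. L) \<noteq> {}"
      using iterated_sumset_mono[OF L(2), of 0 k] by (auto simp: set_zero)
  next
    show "\<forall>V U P F. open U \<and> (\<Sum>j<k. L) + V \<subseteq> U \<and> U \<subseteq> P \<and> compact P \<and> finite F \<and> F \<subseteq> V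
      \<and> (\<forall>x\<in>F. \<forall>y\<in>F. x \<noteq> y \<longrightarrow> f (x - y) = 0)
      \<longrightarrow> card F * (Re (\<integral>x. f x \<partial>M) * (Re (\<integral>x. f x \<partial>M) - 2 * e))
        \<le> measure M U * (Re (f 0) * (Re (\<integral>x. f x \<partial>M) + e))"
    proof (intro allI impI, elim conjE)
      fix V U P F
      assume U: "open U" "(\<Sum>j<k. L) + V \<subseteq> U" "U \<subseteq> P" and P: "compact P"
        and F: "finite F" "F \<subseteq> V"
        and off: "\<forall>x\<in>F. \<forall>y\<in>F. x \<noteq> y \<longrightarrow> f (x - y) = 0"
      obtain \<phi> :: "'a \<Rightarrow> real" where \<phi>m: "\<phi> \<in> borel_measurable borel"
        and \<phi>01: "\<And>x. 0 \<le> \<phi> x" "\<And>x. \<phi> x \<le> 1" and \<phi>out: "\<And>x. x \<notin> U \<Longrightarrow> \<phi> x = 0"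
        and \<phi>in: "\<And>x. \<forall>c\<in>(\<Sum>j<k. L). x + c \<in> U \<Longrightarrow> \<phi> x = 1"
        and \<phi>slow: "\<And>x y. x - y \<in> L \<Longrightarrow> y - x \<in> L \<Longrightarrow> \<bar>\<phi> x - \<phi> y\<bar> \<le> 1 / real k"
        by (rule plateau_function[OF U(1) L k(1)]) blast
      have \<phi>M: "\<phi> \<in> borel_measurable M"
        using \<phi>m by (simp add: measurable_cong_sets[OF sets_haar[OF M] refl])
      have \<phi>P: "\<phi> x = 0" if "x \<notin> P" for x using \<phi>out[of x] U(3) that by blast
      define m where "m = measure M U"
      have Um: "U \<in> sets M" using U(1) by (simp add: sets_haar[OF M])
      have Pm: "P \<in> sets M" using P by (simp add: sets_haar[OF M] compact_imp_closed)
      have Ufin: "emeasure M U < \<infinity>"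
        using emeasure_mono[OF U(3) Pm] haar_compact_finite[OF M P] by (rule order_le_less_trans)
      have Ui: "integrable M (indicator U :: 'a \<Rightarrow> real)"
        using Um Ufin by (simp add: integrable_indicator_iff)
      have \<phi>U: "\<phi> x \<le> indicator U x" for x
        using \<phi>01(2)[of x] \<phi>out[of x] by (auto simp: indicator_def)
      have \<phi>i: "integrable M \<phi>"
        using \<phi>01(1) \<phi>U by (intro Bochner_Integration.integrable_bound[OF Ui \<phi>M] AE_I2) auto
      have \<phi>int: "(\<integral>x. \<phi> x \<partial>M) \<le> m"
        using integral_mono[OF \<phi>i Ui \<phi>U] Um by (simp add: m_def space_haar[OF M])
      have "m \<ge> 0" by (simp add: m_def)
      \<comment> \<open>The discretisation may depend on \<open>U\<close>, so its precision can absorb the factor \<open>m\<close>.\<close>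
      define \<eta> where "\<eta> = e / (2 * (m + 1))"
      have \<eta>: "\<eta> > 0" "\<eta> * m \<le> e / 2"
        using \<open>e > 0\<close> \<open>m \<ge> 0\<close> by (simp_all add: \<eta>_def field_simps)
      obtain N where N: "open N" "0 \<in> N" "\<forall>x y. x - y \<in> N \<longrightarrow> cmod (f x - f y) \<le> \<eta>"
        by (rule positive_definite_uniformly_continuous[OF pd cont \<eta>(1)])
      obtain Z c where Z: "finite Z" and c0: "\<forall>z. 0 \<le> c z" and csum: "(\<Sum>z\<in>Z. c z) = (\<integral>x. \<phi> x \<partial>M)"
        and disc: "\<forall>(h :: 'a \<Rightarrow> complex) \<epsilon>. integrable M (\<lambda>x. \<phi> x * h x)
          \<longrightarrow> (\<forall>x y. x - y \<in> N \<longrightarrow> cmod (h x - h y) \<le> \<epsilon>)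
          \<longrightarrow> cmod ((\<Sum>z\<in>Z. c z * h z) - (\<integral>x. \<phi> x * h x \<partial>M)) \<le> \<epsilon> * (\<integral>x. \<phi> x \<partial>M)"
        by (rule discretise_integral[OF sets_haar[OF M] \<phi>i \<phi>01(1) P \<phi>P N(1,2)])
      have key: "cmod ((\<Sum>z\<in>Z. c z * f (z - w)) - \<phi> w * J) \<le> e" for w
      proof -
        have slow: "\<bar>\<phi> x - \<phi> y\<bar> \<le> 1 / real k" if "x - y \<in> K" for x y
          using that by (intro \<phi>slow) (auto simp: L_def image_iff intro!: bexI[of _ "x - y"])
        note avg = plateau_average[OF M f Km \<phi>M \<phi>01 slow, of w]
        have "cmod ((\<integral>x. \<phi> x * f (x - w) \<partial>M) - \<phi> w * J) \<le> e / 4 + e / 4"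
        proof -
          have "cmod ((\<integral>x. \<phi> x * f (x - w) \<partial>M) - \<phi> w * J)
              \<le> T / k + (\<integral>x. cmod (f x) * indicator (- K) x \<partial>M)"
            using avg(2) by (simp add: J_def T_def)
          then show ?thesis using k(2) K(2) by linarith
        qed
        moreover have "cmod ((\<Sum>z\<in>Z. c z * f (z - w)) - (\<integral>x. \<phi> x * f (x - w) \<partial>M)) \<le> \<eta> * (\<integral>x. \<phi> x \<partial>M)"
          using avg(1) k N(3) by (intro disc[rule_format]) auto
        moreover have "\<eta> * (\<integral>x. \<phi> x \<partial>M) \<le> e / 2"
          using mult_left_mono[OF \<phi>int, of \<eta>] \<eta> by linarith
        ultimately show ?thesis
          using norm_triangle_ineq[of "(\<Sum>z\<in>Z. c z * f (z - w)) - (\<integral>x. \<phi> x * f (x - w) \<partial>M)"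
              "(\<integral>x. \<phi> x * f (x - w) \<partial>M) - \<phi> w * J"] by simp
      qed
      have Re_key: "\<bar>Re (\<Sum>z\<in>Z. c z * f (z - w)) - \<phi> w * I\<bar> \<le> e" for w
      proof -
        have "\<bar>Re ((\<Sum>z\<in>Z. c z * f (z - w)) - \<phi> w * J)\<bar> \<le> e"
          using abs_Re_le_cmod key order_trans by blast
        then show ?thesis by (simp add: I_def)
      qed
      have upper: "(\<Sum>w\<in>Z. c w * Re (\<Sum>z\<in>Z. c z * f (z - w))) \<le> m * (I + e)"
      proof -
        have "(\<Sum>w\<in>Z. c w * Re (\<Sum>z\<in>Z. c z * f (z - w))) \<le> (\<Sum>w\<in>Z. c w * (I + e))"
        proof (intro sum_mono mult_left_mono c0[rule_format])
          fix w
          have "\<phi> w * I \<le> I" using \<phi>01[of w] \<open>I > 0\<close> by simp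
          then show "Re (\<Sum>z\<in>Z. c z * f (z - w)) \<le> I + e" using Re_key[of w] by linarith
        qed
        also have "\<dots> = (\<integral>x. \<phi> x \<partial>M) * (I + e)" by (simp add: sum_distrib_right[symmetric] csum)
        also have "\<dots> \<le> m * (I + e)" using \<phi>int \<open>I > 0\<close> \<open>e > 0\<close> by (intro mult_right_mono) auto
        finally show ?thesis .
      qed
      have lower: "card F * (I - e) \<le> (\<Sum>w\<in>F. Re (\<Sum>z\<in>Z. c z * f (z - w)))"
      proof -
        have "I - e \<le> Re (\<Sum>z\<in>Z. c z * f (z - w))" if "w \<in> F" for w
        proof -
          have "\<forall>c\<in>(\<Sum>j<k. L). w + c \<in> U"
          proof
            fix c assume "c \<in> (\<Sum>j<k. L)"
            then have "c + w \<in> (\<Sum>j<k. L) + V" using F(2) \<open>w \<in> F\<close> by (intro set_plus_intro) auto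
            then show "w + c \<in> U" using U(2) by (auto simp: add.commute)
          qed
          then have "\<phi> w = 1" by (rule \<phi>in)
          then show ?thesis using Re_key[of w] by simp
        qed
        then show ?thesis using sum_mono[of F "\<lambda>_. I - e"] by simp
      qed
      define r where "r = Re (f 0)"
      have "r > 0" using f0 by (simp add: r_def)
      have "0 \<le> m * (I + e) - 2 * (I / r) * (card F * (I - e)) + (I / r)\<^sup>2 * card F * r"
        using positive_definite_test_sum[OF pd Z F(1) off[rule_format], of c "I / r"] upper
          mult_left_mono[OF lower, of "2 * (I / r)"] \<open>I > 0\<close> \<open>r > 0\<close>
        by (simp add: r_def)
      from mult_left_mono[OF this, of r] have "0 \<le> r * m * (I + e) - 2 * I * (card F * (I - e)) + I\<^sup>2 * card F"
        using \<open>r > 0\<close> by (simp add: algebra_simps power2_eq_square)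
      then have "card F * (I * (I - 2 * e)) \<le> m * (r * (I + e))"
        by (simp add: algebra_simps power2_eq_square)
      then show "card F * (Re (\<integral>x. f x \<partial>M) * (Re (\<integral>x. f x \<partial>M) - 2 * e))
          \<le> measure M U * (Re (f 0) * (Re (\<integral>x. f x \<partial>M) + e))"
        by (simp add: I_def J_def r_def m_def)
    qed
  qed
qed

section \<open>From the packing estimate to the Turan constant\<close>

lemma locally_compact_neighbourhood_of_compact:
  fixes P :: "'a::t2_space set"
  assumes lc: "locally_compact_space (euclidean :: 'a topology)" and "compact P"
  obtains W Q where "open W" "compact Q" "P \<subseteq> W" "W \<subseteq> Q"
proof -
  have "\<forall>x::'a. \<exists>U K. open U \<and> compact K \<and> x \<in> U \<and> U \<subseteq> K"
    using lc unfolding locally_compact_space_def by simp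
  then obtain U K :: "'a \<Rightarrow> 'a set" where UK: "\<And>x. open (U x)" "\<And>x. compact (K x)" "\<And>x. x \<in> U x" "\<And>x. U x \<subseteq> K x"
    by metis
  have "P \<subseteq> (\<Union>x\<in>P. U x)" using UK(3) by blast
  then obtain D where D: "D \<subseteq> P" "finite D" "P \<subseteq> (\<Union>x\<in>D. U x)"
    by (rule compactE_image[OF \<open>compact P\<close> UK(1)])
  show ?thesis
  proof (rule that)
    show "open (\<Union>x\<in>D. U x)" using UK(1) by auto
    show "compact (\<Union>x\<in>D. K x)" using D(2) UK(2) by (intro compact_UN) auto
    show "P \<subseteq> (\<Union>x\<in>D. U x)" by (rule D(3))
    show "(\<Union>x\<in>D. U x) \<subseteq> (\<Union>x\<in>D. K x)" using UK(4) by blast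
  qed
qed

lemma haar_outer_measure_greatest:
  assumes M: "haar_measure M"
    and le: "\<And>U. open U \<Longrightarrow> A \<subseteq> U \<Longrightarrow> n \<le> emeasure M U"
  shows "n \<le> outer_measure_of M A"
  unfolding outer_measure_of_def
proof (rule INF_greatest)
  fix B assume B: "B \<in> {B \<in> sets M. A \<subseteq> B}"
  then have "B \<in> sets borel" by (simp add: sets_haar[OF M])
  then show "n \<le> emeasure M B"
    using B by (subst haar_outer_regular[OF M]) (auto intro!: INF_greatest le)
qed

text \<open>
  A bound by the measures of relatively compact open sets suffices: \<open>C + V\<close> has an open neighbourhood
  \<open>W\<close> with compact closure, each open \<open>U\<close> around \<open>C + V\<close> may be cut down to \<open>U \<inter> W\<close>, and outer regularity
  turns open supersets into the outer measure. The bound on finite subsets also shows that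
  \<open>\<Lambda> \<inter> V\<close> is finite, so that its counting measure is its cardinality.
\<close>

lemma density_le_of_packing_estimate:
  fixes M :: "'a::{topological_ab_group_add, t2_space} measure" and q :: real
  assumes lc: "locally_compact_space (euclidean :: 'a topology)" and M: "haar_measure M"
    and "q > 0" and C: "compact C" "C \<noteq> {}"
    and est: "\<And>V U P F. open U \<Longrightarrow> C + V \<subseteq> U \<Longrightarrow> U \<subseteq> P \<Longrightarrow> compact P \<Longrightarrow> finite F
      \<Longrightarrow> F \<subseteq> \<Lambda> \<inter> V \<Longrightarrow> card F \<le> q * measure M U"
  shows "asymp_uniform_upper_density M \<Lambda> \<le> ennreal q"
proof -
  have "emeasure (count_space UNIV) (\<Lambda> \<inter> V) / outer_measure_of M (C + V) \<le> ennreal q"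
    if V: "compact (closure V)" for V
  proof -
    have "C + V \<subseteq> C + closure V" by (intro set_plus_mono2 closure_subset order_refl)
    moreover obtain W Q where W: "open W" "compact Q" "C + closure V \<subseteq> W" "W \<subseteq> Q"
      using locally_compact_neighbourhood_of_compact[OF lc compact_set_plus[OF C(1) V]] by blast
    ultimately have CV: "C + V \<subseteq> W" by blast
    have bound: "card F \<le> q * measure M (U \<inter> W)"
      if "open U" "C + V \<subseteq> U" "finite F" "F \<subseteq> \<Lambda> \<inter> V" for U F
      using that W CV by (intro est[of _ V Q]) auto
    have fin: "finite (\<Lambda> \<inter> V)"
    proof (rule finite_if_finite_subsets_card_bdd[THEN conjunct1])
      show "card F \<le> nat \<lfloor>q * measure M W\<rfloor>" if "F \<subseteq> \<Lambda> \<inter> V" "finite F" for F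
        using bound[OF W(1) CV that(2,1)] by (intro le_nat_floor) simp
    qed
    have "ennreal (card (\<Lambda> \<inter> V) / q) \<le> outer_measure_of M (C + V)"
    proof (rule haar_outer_measure_greatest[OF M])
      fix U assume U: "open U" "C + V \<subseteq> U"
      have WU: "U \<inter> W \<in> sets M" "U \<in> sets M" using U(1) W(1) by (auto simp: sets_haar[OF M])
      have "emeasure M (U \<inter> W) \<le> emeasure M Q"
        using W by (intro emeasure_mono) (auto simp: sets_haar[OF M] compact_imp_closed)
      also have "\<dots> < \<infinity>" by (rule haar_compact_finite[OF M W(2)])
      finally have "emeasure M (U \<inter> W) = ennreal (measure M (U \<inter> W))"
        by (intro emeasure_eq_ennreal_measure) auto
      moreover have "card (\<Lambda> \<inter> V) / q \<le> measure M (U \<inter> W)"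
        using bound[OF U fin order_refl] \<open>q > 0\<close> by (simp add: field_simps)
      ultimately have "ennreal (card (\<Lambda> \<inter> V) / q) \<le> emeasure M (U \<inter> W)"
        by (simp add: ennreal_leI)
      also have "\<dots> \<le> emeasure M U" using WU by (intro emeasure_mono) auto
      finally show "ennreal (card (\<Lambda> \<inter> V) / q) \<le> emeasure M U" .
    qed
    from mult_left_mono[OF this, of "ennreal q"]
    have count: "emeasure (count_space UNIV) (\<Lambda> \<inter> V) \<le> ennreal q * outer_measure_of M (C + V)"
      using fin \<open>q > 0\<close> by (simp add: ennreal_mult[symmetric] ennreal_of_nat_eq_real_of_nat)
    show ?thesis
    proof (cases "outer_measure_of M (C + V) = 0")
      \<comment> \<open>Then \<open>\<Lambda> \<inter> V\<close> is empty and the quotient is \<open>0 / 0 = 0\<close>.\<close>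
      case True
      then show ?thesis using count by simp
    next
      case False
      then show ?thesis using count by (intro divide_le_posI_ennreal) (auto simp: zero_less_iff_neq_zero mult.commute)
    qed
  qed
  then show ?thesis
    unfolding asymp_uniform_upper_density_def
    using C by (intro INF_lower2[of C] SUP_least) auto
qed

text \<open>
  For each small \<open>e > 0\<close> the packing estimate bounds the density by \<open>f(0) (I + e) / (I (I - 2 e))\<close>, and
  \<open>e\<close> tends to \<open>0\<close>. The restriction \<open>e < I / 2\<close> keeps the denominator positive.
\<close>

lemma density_le_of_positive_definite:
  fixes M :: "'a::{topological_ab_group_add, t2_space} measure" and f :: "'a \<Rightarrow> complex"
  assumes lc: "locally_compact_space (euclidean :: 'a topology)" and M: "haar_measure M"
    and pd: "positive_definite_fun f" and cont: "continuous_on UNIV f" and f: "integrable M f"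
    and f0: "0 < Re (f 0)" and I: "0 < Re (\<integral>x. f x \<partial>M)"
    and off: "\<And>x y. x \<in> \<Lambda> \<Longrightarrow> y \<in> \<Lambda> \<Longrightarrow> x \<noteq> y \<Longrightarrow> f (x - y) = 0"
  shows "asymp_uniform_upper_density M \<Lambda> \<le> ennreal (Re (f 0) / Re (\<integral>x. f x \<partial>M))"
proof -
  define r where "r = Re (f 0)"
  define s where "s = Re (\<integral>x. f x \<partial>M)"
  have rs: "r > 0" "s > 0" using f0 I by (simp_all add: r_def s_def)
  define q where "q = (\<lambda>e. r * (s + e) / (s * (s - 2 * e)))"
  have est: "asymp_uniform_upper_density M \<Lambda> \<le> ennreal (q e)" if e: "0 < e" "e < s / 2" for e
  proof -
    have pos: "s * (s - 2 * e) > 0" using e rs by simp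
    obtain C where C: "compact C" "C \<noteq> {}" and
      pack: "\<forall>V U P F. open U \<and> C + V \<subseteq> U \<and> U \<subseteq> P \<and> compact P \<and> finite F \<and> F \<subseteq> V
      \<and> (\<forall>x\<in>F. \<forall>y\<in>F. x \<noteq> y \<longrightarrow> f (x - y) = 0)
      \<longrightarrow> card F * (s * (s - 2 * e)) \<le> measure M U * (r * (s + e))"
      unfolding r_def s_def by (rule packing_estimate[OF M pd cont f f0 I e(1)])
    show ?thesis
    proof (rule density_le_of_packing_estimate[OF lc M _ C])
      show "q e > 0" using pos rs e by (simp add: q_def)
      fix V U P F
      assume "open U" "C + V \<subseteq> U" "U \<subseteq> P" "compact P" "finite F" "F \<subseteq> \<Lambda> \<inter> V"
      then have "card F * (s * (s - 2 * e)) \<le> measure M U * (r * (s + e))"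
        by (intro pack[rule_format, of U V P F]) (auto intro!: off)
      then show "card F \<le> q e * measure M U"
        using pos by (simp add: q_def pos_le_divide_eq mult_ac)
    qed
  qed
  have "(q \<longlongrightarrow> r * (s + 0) / (s * (s - 2 * 0))) (at_right 0)"
    unfolding q_def using rs by (intro tendsto_intros) auto
  then have lim: "((\<lambda>e. ennreal (q e)) \<longlongrightarrow> ennreal (r / s)) (at_right 0)"
    using rs by (intro tendsto_ennrealI) simp
  have "eventually (\<lambda>e. asymp_uniform_upper_density M \<Lambda> \<le> ennreal (q e)) (at_right 0)"
    unfolding eventually_at_right_field using est rs by (intro exI[of _ "s / 2"]) auto
  from tendsto_lowerbound[OF lim this] show ?thesis
    by (simp add: r_def s_def)
qed

lemma ennreal_inverse_antimono:
  fixes a b :: ennreal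
  shows "a \<le> b \<Longrightarrow> inverse b \<le> inverse a"
  by (simp add: less_eq_ennreal.rep_eq inverse_ennreal.rep_eq ereal_inverse_antimono)

theorem theorem7:
  fixes M :: "'a::{topological_ab_group_add, t2_space} measure"
    and \<Omega> \<Lambda> :: "'a set"
  assumes "locally_compact_space (euclidean :: 'a topology)"
    and "haar_measure M"
    and "open \<Omega>" and "0 \<in> \<Omega>" and "uminus ` \<Omega> = \<Omega>"
    and "\<Omega> \<inter> {x - y |x y. x \<in> \<Lambda> \<and> y \<in> \<Lambda>} = {0}"
    and "asymp_uniform_upper_density M \<Lambda> > 0"
  shows "turan_constant M \<Omega> \<le> enn2ereal (1 / asymp_uniform_upper_density M \<Lambda>)"
  unfolding turan_constant_def
proof (rule SUP_least)
  fix f assume "f \<in> {f. turan_admissible M \<Omega> f}"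
  then have cont: "continuous_on UNIV f" and pd: "positive_definite_fun f" and f: "integrable M f"
    and nz: "\<exists>x. f x \<noteq> 0" and supp: "closure {x. f x \<noteq> 0} \<subseteq> \<Omega>"
    by (auto simp: turan_admissible_def)
  obtain x where "f x \<noteq> 0" using nz by blast
  then have "0 < cmod (f x)" by simp
  also have "\<dots> \<le> Re (f 0)" by (rule positive_definite_bounded[OF pd])
  finally have f0: "0 < Re (f 0)" .
  have "f 0 = complex_of_real (Re (f 0))"
    using positive_definite_zero(1)[OF pd] by (simp add: complex_eq_iff)
  then have quot: "Re ((\<integral>x. f x \<partial>M) / f 0) = Re (\<integral>x. f x \<partial>M) / Re (f 0)"
    by (metis Re_divide_of_real)
  show "ereal (Re ((\<integral>x. f x \<partial>M) / f 0)) \<le> enn2ereal (1 / asymp_uniform_upper_density M \<Lambda>)"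
  proof (cases "0 < Re (\<integral>x. f x \<partial>M)")
    case False
    then have "ereal (Re ((\<integral>x. f x \<partial>M) / f 0)) \<le> 0"
      using f0 unfolding quot by (simp add: divide_nonpos_pos)
    then show ?thesis using enn2ereal_nonneg order_trans by blast
  next
    case True
    have "f (x - y) = 0" if "x \<in> \<Lambda>" "y \<in> \<Lambda>" "x \<noteq> y" for x y
    proof (rule ccontr)
      assume "f (x - y) \<noteq> 0"
      then have "x - y \<in> closure {x. f x \<noteq> 0}" by (intro subsetD[OF closure_subset]) simp
      then have "x - y \<in> \<Omega> \<inter> {x - y |x y. x \<in> \<Lambda> \<and> y \<in> \<Lambda>}" using that supp by auto
      then show False unfolding assms(6) using \<open>x \<noteq> y\<close> by simp
    qed
    from density_le_of_positive_definite[OF assms(1,2) pd cont f f0 True this]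
    have "1 / ennreal (Re (f 0) / Re (\<integral>x. f x \<partial>M)) \<le> 1 / asymp_uniform_upper_density M \<Lambda>"
      by (simp add: divide_ennreal_def ennreal_inverse_antimono)
    moreover have "1 / ennreal (Re (f 0) / Re (\<integral>x. f x \<partial>M))
        = ennreal (Re (\<integral>x. f x \<partial>M) / Re (f 0))"
      using f0 True by (simp add: divide_ennreal flip: ennreal_1)
    ultimately have "enn2ereal (ennreal (Re (\<integral>x. f x \<partial>M) / Re (f 0)))
        \<le> enn2ereal (1 / asymp_uniform_upper_density M \<Lambda>)"
      by (simp add: less_eq_ennreal.rep_eq)
    then show ?thesis using f0 True unfolding quot by simp
  qed
qed

end
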